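(* Let $\psi:\mathcal{H}\to\mathbb{R}$ be of class $C^2$ and bounded from below, and assume that $V(x)=\frac12\|\nabla\psi(x)\|^2$ is convex on $\mathcal{H}$. Let $u_0\in\mathcal{H}$. Then the second order system $v''(t)=\nabla V(v(t))$, $t\ge0$, has a unique strongly evanescent solution satisfying $v(0)=u_0$, and this solution is also the unique solution of the first order system $u'(t)=-\nabla\psi(u(t))$, $t\ge0$, satisfying $u(0)=u_0$.
   Context: $\mathcal{H}$ is a real Hilbert space with norm $\|\cdot\|$. A global solution of $v''(t)=\nabla V(v(t))$ is a function $v\in C^2([0,+\infty),\mathcal{H})$ satisfying the equation for all $t\ge 0$. A global solution $v$ is called strongly evanescent if $\int_0^{+\infty}\left(\|v'(t)\|^2+V(v(t))\right)dt<+\infty$. *)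

theory Defs
  imports "HOL-Analysis.Analysis"
begin

text \<open>
  A real Hilbert space is a type of sort \<open>{real_inner, banach}\<close>: an inner product space,
  not assumed separable or finite-dimensional, that is complete.
\<close>

text \<open>
  The value is meaningful only where \<open>f\<close> is Frechet differentiable; in a Hilbert space the
  representing vector then exists and is unique by the Riesz theorem.
\<close>

definition gradient :: "('a::real_inner \<Rightarrow> real) \<Rightarrow> 'a \<Rightarrow> 'a" where
  "gradient f x = (THE g. GDERIV f x :> g)"

text \<open>
  \<open>D1\<close> and \<open>D2\<close> are the first and second Frechet derivatives, the second one being continuous
  in operator norm.
\<close>

definition C2_on_space :: "('a::real_normed_vector \<Rightarrow> 'b::real_normed_vector) \<Rightarrow> bool" where
  "C2_on_space f \<longleftrightarrow>
     (\<exists>(D1 :: 'a \<Rightarrow> 'a \<Rightarrow>\<^sub>L 'b) (D2 :: 'a \<Rightarrow> 'a \<Rightarrow>\<^sub>L ('a \<Rightarrow>\<^sub>L 'b)).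
        (\<forall>x. (f has_derivative blinfun_apply (D1 x)) (at x)) \<and>
        (\<forall>x. (D1 has_derivative blinfun_apply (D2 x)) (at x)) \<and>
        continuous_on UNIV D2)"

text \<open>
  A curve on \<open>[0, +\<infinity>)\<close> is a total function \<open>real \<Rightarrow> 'a\<close> whose values at negative times are
  irrelevant: derivatives are taken within \<open>{0..}\<close>, hence are one-sided at \<open>0\<close>.
\<close>

definition hl_deriv :: "(real \<Rightarrow> 'a::real_normed_vector) \<Rightarrow> real \<Rightarrow> 'a" where
  "hl_deriv v t = vector_derivative v (at t within {0..})"

definition C2_halfline :: "(real \<Rightarrow> 'a::real_normed_vector) \<Rightarrow> bool" where
  "C2_halfline v \<longleftrightarrow>
     v differentiable_on {0..} \<and>
     hl_deriv v differentiable_on {0..} \<and>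
     continuous_on {0..} (hl_deriv (hl_deriv v))"

definition global_solution :: "('a::real_inner \<Rightarrow> real) \<Rightarrow> (real \<Rightarrow> 'a) \<Rightarrow> bool" where
  "global_solution V v \<longleftrightarrow>
     C2_halfline v \<and> (\<forall>t\<ge>0. hl_deriv (hl_deriv v) t = gradient V (v t))"

text \<open>
  For \<open>V \<ge> 0\<close> the integrand is nonnegative and continuous on \<open>{0..}\<close>, so that finiteness of the
  integral is integrability.
\<close>

definition strongly_evanescent :: "('a::real_inner \<Rightarrow> real) \<Rightarrow> (real \<Rightarrow> 'a) \<Rightarrow> bool" where
  "strongly_evanescent V v \<longleftrightarrow>
     global_solution V v \<and>
     set_integrable lborel {0..} (\<lambda>t. (norm (hl_deriv v t))\<^sup>2 + V (v t))"

definition gradient_flow :: "('a::real_inner \<Rightarrow> real) \<Rightarrow> (real \<Rightarrow> 'a) \<Rightarrow> bool" where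
  "gradient_flow \<psi> u \<longleftrightarrow>
     (\<forall>t\<ge>0. (u has_vector_derivative - gradient \<psi> (u t)) (at t within {0..}))"

end

theory Submission
  imports Defs
begin

text \<open>
  Write \<open>F\<close> for the gradient of \<open>\<psi>\<close> and \<open>A\<close> for its Hessian, so that \<open>V = 1 / 2 * (norm F)\<^sup>2\<close>. As
  \<open>A\<close> is symmetric, the gradient of \<open>V\<close> is \<open>A F\<close>, and a solution of \<open>u' = - F (u)\<close> satisfies
  \<open>u'' = - A (u) u' = A (u) (F (u))\<close>: the gradient flow solves the second order equation. Along it
  \<open>(norm u')\<^sup>2 + V (u) = 3 / 2 * (norm (F (u)))\<^sup>2\<close> is \<open>- 3 / 2\<close> times the derivative of \<open>\<psi> (u)\<close>,
  which is integrable because \<open>\<psi>\<close> is bounded below. So every curve of the gradient flow is strongly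
  evanescent (\<open>gradient_flow_strongly_evanescent\<close>).

  The flow exists for all times (\<open>gradient_flow_exists\<close>), although \<open>F\<close> is only locally Lipschitz:
  the integral of \<open>(norm u')\<^sup>2\<close> is bounded by the decrease of \<open>\<psi>\<close>, so that \<open>u\<close> is Hoelder
  continuous with exponent \<open>1 / 2\<close>. At a finite maximal time \<open>u\<close> would then have a limit, and
  the Picard theorem near this limit would continue it.

  Two strongly evanescent solutions with the same initial value agree
  (\<open>strongly_evanescent_unique\<close>). Convexity of \<open>V\<close> makes its gradient monotone, hence the
  squared distance of two solutions is a convex function of time, starting at \<open>0\<close> with slope
  \<open>0\<close>. Unless it vanishes it grows at least linearly, but the square integrability of the
  velocities forces it to grow slower than any linear function. Since curves of the gradient flow
  are strongly evanescent, this also gives their uniqueness.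
\<close>

section \<open>Gradients and Hessians in a Hilbert space\<close>

text \<open>
  The representing vector minimises \<open>J x = (x \<bullet> x) / 2 - f x\<close>. By the parallelogram law a
  minimising sequence is Cauchy, and the variation of \<open>J\<close> vanishes at its limit.
\<close>

lemma riesz_representation:
  fixes f :: "'a::{real_inner, banach} \<Rightarrow>\<^sub>L real"
  shows "\<exists>g. \<forall>h. f h = g \<bullet> h"
proof -
  define J where "J x = x \<bullet> x / 2 - f x" for x
  define I where "I = Inf (range J)"
  have J_ge: "J x \<ge> - (norm f)\<^sup>2 / 2" for x
  proof -
    have "f x \<le> norm f * norm x"
      using norm_blinfun[of f x] by simp
    moreover have "0 \<le> (norm f - norm x)\<^sup>2"
      by simp
    ultimately show ?thesis
      by (simp add: J_def power2_diff dot_square_norm)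
  qed
  have bdd: "bdd_below (range J)"
    by (rule bdd_belowI2[of _ "- (norm f)\<^sup>2 / 2"]) (rule J_ge)
  have I_le: "I \<le> J x" for x
    unfolding I_def by (rule cInf_lower[OF _ bdd]) simp
  have par: "(norm (x - y))\<^sup>2 \<le> 4 * (J x + J y - 2 * I)" for x y
  proof -
    define z where "z = (1/2) *\<^sub>R (x + y)"
    have "4 * (J x + J y - 2 * J z) = (norm (x - y))\<^sup>2"
      by (simp add: J_def z_def power2_norm_eq_inner inner_add_left inner_add_right inner_diff_left
          inner_diff_right blinfun.add_right blinfun.scaleR_right inner_commute algebra_simps)
    with I_le[of z] show ?thesis by (smt (verit))
  qed
  have "\<exists>x. J x < I + 1 / (real n + 1)" for n
    using cInf_lessD[of "range J" "I + 1 / (real n + 1)"] unfolding I_def by force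
  then obtain X where X: "\<And>n. J (X n) < I + 1 / (real n + 1)" by metis
  have "Cauchy X"
    unfolding Cauchy_def
  proof (intro allI impI)
    fix e :: real assume "e > 0"
    then obtain N :: nat where N: "8 / e\<^sup>2 < N" using reals_Archimedean2 by blast
    have "dist (X m) (X n) < e" if "m \<ge> N" "n \<ge> N" for m n
    proof -
      have "1 / (real k + 1) < e\<^sup>2 / 8" if "k \<ge> N" for k
      proof -
        have "8 / e\<^sup>2 < real k + 1" using N that by linarith
        then show ?thesis using \<open>e > 0\<close> by (simp add: field_simps)
      qed
      with that have "1 / (real m + 1) < e\<^sup>2 / 8" "1 / (real n + 1) < e\<^sup>2 / 8" by auto
      with par[of "X m" "X n"] X[of m] X[of n] have "(norm (X m - X n))\<^sup>2 < e\<^sup>2" by argo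
      then show ?thesis
        using \<open>e > 0\<close> by (simp add: dist_norm power_less_imp_less_base)
    qed
    then show "\<exists>M. \<forall>m\<ge>M. \<forall>n\<ge>M. dist (X m) (X n) < e" by blast
  qed
  then obtain g where g: "X \<longlonglongrightarrow> g"
    using Cauchy_convergent_iff convergent_def by blast
  have "(\<lambda>n. J (X n)) \<longlonglongrightarrow> J g"
    unfolding J_def by (auto intro!: tendsto_intros g)
  moreover have "(\<lambda>n. I + 1 / (real n + 1)) \<longlonglongrightarrow> I"
    using tendsto_add[OF tendsto_const LIMSEQ_inverse_real_of_nat, of I]
    by (simp add: inverse_eq_divide add.commute)
  ultimately have J_min: "J g \<le> I"
    using X by (intro LIMSEQ_le[of "\<lambda>n. J (X n)" _ "\<lambda>n. I + 1 / (real n + 1)"]) (auto intro: less_imp_le)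
  have "f h = g \<bullet> h" for h
  proof -
    define c where "c = g \<bullet> h - f h"
    have quad: "0 \<le> t * c + t\<^sup>2 * (h \<bullet> h) / 2" for t
      using I_le[of "g + t *\<^sub>R h"] J_min
      by (simp add: J_def c_def inner_add_left inner_add_right blinfun.add_right
          blinfun.scaleR_right inner_commute power2_eq_square algebra_simps)
    have "c = 0"
    proof (rule ccontr)
      assume "c \<noteq> 0"
      define s where "s = h \<bullet> h + 1"
      have s: "s > 0" "h \<bullet> h < s" by (simp_all add: s_def add_nonneg_pos)
      \<comment> \<open>For small \<open>t\<close> of the sign of \<open>- c\<close> the linear term dominates and \<open>quad\<close> fails.\<close>
      have "0 \<le> (- c / s) * c + (- c / s)\<^sup>2 * (h \<bullet> h) / 2" by (rule quad)
      also have "\<dots> \<le> (- c / s) * c + (- c / s)\<^sup>2 * s / 2"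
        using s by (intro add_left_mono divide_right_mono mult_left_mono) auto
      also have "\<dots> = - (c\<^sup>2 / (2 * s))"
        using s by (simp add: field_simps power2_eq_square)
      also have "\<dots> < 0" using s \<open>c \<noteq> 0\<close> by simp
      finally show False by simp
    qed
    then show ?thesis by (simp add: c_def)
  qed
  then show ?thesis by blast
qed

text \<open>
  The Riesz map from functionals to vectors is linear and bounded, so it carries the derivatives
  of \<open>\<psi>\<close> as functionals to derivatives of the gradient as a vector field.
\<close>

lemma C2_on_space_imp_gradient_derivative:
  fixes \<psi> :: "'a::{real_inner, banach} \<Rightarrow> real"
  assumes "C2_on_space \<psi>"
  obtains F :: "'a \<Rightarrow> 'a" and A :: "'a \<Rightarrow> 'a \<Rightarrow>\<^sub>L 'a"
  where "\<And>x. (\<psi> has_derivative (\<lambda>h. F x \<bullet> h)) (at x)"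
    and "\<And>x. (F has_derivative blinfun_apply (A x)) (at x)"
    and "continuous_on UNIV A"
proof -
  from assms obtain D1 :: "'a \<Rightarrow> 'a \<Rightarrow>\<^sub>L real" and D2 :: "'a \<Rightarrow> 'a \<Rightarrow>\<^sub>L ('a \<Rightarrow>\<^sub>L real)"
    where D1: "\<And>x. (\<psi> has_derivative blinfun_apply (D1 x)) (at x)"
      and D2: "\<And>x. (D1 has_derivative blinfun_apply (D2 x)) (at x)"
      and cont: "continuous_on UNIV D2"
    unfolding C2_on_space_def by blast
  obtain R :: "('a \<Rightarrow>\<^sub>L real) \<Rightarrow> 'a" where R: "\<And>f h. blinfun_apply f h = R f \<bullet> h"
    using riesz_representation by metis
  have R_unique: "R f = g" if "\<And>h. blinfun_apply f h = g \<bullet> h" for f g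
  proof -
    have "(R f - g) \<bullet> (R f - g) = 0"
      using that[of "R f - g"] R[of f "R f - g"] by (simp add: inner_diff_left)
    then show ?thesis by simp
  qed
  have R_norm: "norm (R f) \<le> norm f" for f
  proof (cases "R f = 0")
    case False
    have "norm (R f) * norm (R f) = f (R f)"
      by (simp add: R dot_square_norm power2_eq_square)
    also have "\<dots> \<le> norm f * norm (R f)"
      using norm_blinfun[of f "R f"] by simp
    finally show ?thesis using False by simp
  qed simp
  have R_lin: "bounded_linear R"
  proof (rule bounded_linear_intro[where K = 1])
    show "R (f + g) = R f + R g" for f g
      by (rule R_unique) (simp add: blinfun.add_left inner_add_left flip: R)
    show "R (c *\<^sub>R f) = c *\<^sub>R R f" for c f
      by (rule R_unique) (simp add: blinfun.scaleR_left flip: R)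
  qed (simp add: R_norm)
  define A where "A x = Blinfun R o\<^sub>L D2 x" for x
  show thesis
  proof
    show "(\<psi> has_derivative (\<lambda>h. R (D1 x) \<bullet> h)) (at x)" for x
      using D1[of x] by (simp flip: R)
    show "((\<lambda>x. R (D1 x)) has_derivative blinfun_apply (A x)) (at x)" for x
    proof -
      have "blinfun_apply (A x) = (\<lambda>h. R (D2 x h))"
        by (simp add: A_def fun_eq_iff bounded_linear_Blinfun_apply[OF R_lin])
      then show ?thesis
        using bounded_linear.has_derivative[OF R_lin D2[of x]] by simp
    qed
    show "continuous_on UNIV A"
      unfolding A_def by (intro continuous_intros cont)
  qed
qed

lemma has_real_derivative_along_line:
  fixes f :: "'a::real_inner \<Rightarrow> real"
  assumes "(f has_derivative (\<lambda>h. g \<bullet> h)) (at (p + r *\<^sub>R a))"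
  shows "((\<lambda>s. f (p + s *\<^sub>R a)) has_real_derivative g \<bullet> a) (at r)"
proof -
  have "((\<lambda>s. p + s *\<^sub>R a) has_derivative (\<lambda>s. s *\<^sub>R a)) (at r)"
    by (auto intro!: derivative_eq_intros)
  from has_derivative_compose[OF this assms] show ?thesis
    by (simp add: has_field_derivative_def mult.commute[of _ "g \<bullet> a"] fun_eq_iff)
qed

text \<open>
  Two applications of the mean value theorem to the second difference of \<open>\<psi>\<close>, in either order,
  give values of the Hessian form at points near \<open>x\<close>; continuity identifies both with the
  value at \<open>x\<close>.
\<close>

lemma hessian_symmetric:
  fixes \<psi> :: "'a::real_inner \<Rightarrow> real" and A :: "'a \<Rightarrow> 'a \<Rightarrow>\<^sub>L 'a"
  assumes \<psi>: "\<And>x. (\<psi> has_derivative (\<lambda>h. F x \<bullet> h)) (at x)"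
    and F: "\<And>x. (F has_derivative blinfun_apply (A x)) (at x)"
    and A: "continuous_on UNIV A"
  shows "A x h \<bullet> k = h \<bullet> A x k"
proof -
  have F_line: "((\<lambda>r. F (p + r *\<^sub>R b) \<bullet> a) has_real_derivative A (p + r *\<^sub>R b) b \<bullet> a) (at r)" for p a b r
    unfolding has_field_derivative_def
    by (rule derivative_eq_intros has_derivative_compose[of _ _ _ _ F, OF _ F] refl
        | simp add: blinfun.scaleR_right fun_eq_iff)+
  have \<psi>_line: "((\<lambda>r. \<psi> (p + r *\<^sub>R a)) has_real_derivative F (p + r *\<^sub>R a) \<bullet> a) (at r)" for p a r
    by (intro has_real_derivative_along_line \<psi>)
  have second_difference: "\<exists>r s. 0 < r \<and> r < t \<and> 0 < s \<and> s < t \<and>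
      \<psi> (x + t *\<^sub>R a + t *\<^sub>R b) - \<psi> (x + t *\<^sub>R a) - \<psi> (x + t *\<^sub>R b) + \<psi> x
        = t\<^sup>2 * (A (x + r *\<^sub>R a + s *\<^sub>R b) b \<bullet> a)"
    if "t > 0" for t a b
  proof -
    have "\<exists>r>0. r < t \<and> (\<psi> (x + t *\<^sub>R b + t *\<^sub>R a) - \<psi> (x + t *\<^sub>R a)) -
        (\<psi> (x + t *\<^sub>R b + 0 *\<^sub>R a) - \<psi> (x + 0 *\<^sub>R a))
        = (t - 0) * (F (x + t *\<^sub>R b + r *\<^sub>R a) \<bullet> a - F (x + r *\<^sub>R a) \<bullet> a)"
      using that by (intro MVT2 DERIV_diff \<psi>_line) auto
    then obtain r where r: "0 < r" "r < t"
      and r_eq: "\<psi> (x + t *\<^sub>R a + t *\<^sub>R b) - \<psi> (x + t *\<^sub>R a) - \<psi> (x + t *\<^sub>R b) + \<psi> x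
        = t * (F (x + r *\<^sub>R a + t *\<^sub>R b) \<bullet> a - F (x + r *\<^sub>R a) \<bullet> a)"
      by (auto simp: algebra_simps)
    have "\<exists>s>0. s < t \<and> F (x + r *\<^sub>R a + t *\<^sub>R b) \<bullet> a - F (x + r *\<^sub>R a + 0 *\<^sub>R b) \<bullet> a
        = (t - 0) * (A (x + r *\<^sub>R a + s *\<^sub>R b) b \<bullet> a)"
      using that by (intro MVT2 F_line) auto
    with r r_eq show ?thesis by (auto simp: power2_eq_square)
  qed
  have near: "\<exists>d>0. \<forall>r s. 0 < r \<longrightarrow> r < d \<longrightarrow> 0 < s \<longrightarrow> s < d \<longrightarrow>
      \<bar>A (x + r *\<^sub>R a + s *\<^sub>R b) b \<bullet> a - A x b \<bullet> a\<bar> < e"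
    if "e > 0" for a b and e :: real
  proof -
    have "continuous_on UNIV (\<lambda>y. A y b \<bullet> a)"
      by (intro continuous_intros A)
    then have "isCont (\<lambda>y. A y b \<bullet> a) x"
      by (simp add: continuous_on_eq_continuous_at)
    then obtain d where d: "d > 0" "\<And>y. dist y x < d \<Longrightarrow> dist (A y b \<bullet> a) (A x b \<bullet> a) < e"
      using \<open>e > 0\<close> unfolding continuous_at_eps_delta by blast
    have "dist (x + r *\<^sub>R a + s *\<^sub>R b) x < d"
      if "0 < r" "r < d / (norm a + norm b + 1)" "0 < s" "s < d / (norm a + norm b + 1)" for r s
    proof -
      let ?q = "d / (norm a + norm b + 1)"
      have pos: "norm a + norm b + 1 > 0" by (simp add: add_nonneg_pos)
      have "dist (x + r *\<^sub>R a + s *\<^sub>R b) x \<le> r * norm a + s * norm b"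
        using that norm_triangle_ineq[of "r *\<^sub>R a" "s *\<^sub>R b"] by (simp add: dist_norm add.assoc)
      also have "\<dots> \<le> ?q * norm a + ?q * norm b"
        using that by (intro add_mono mult_right_mono) auto
      also have "\<dots> < ?q * (norm a + norm b + 1)"
        using d pos by (simp add: distrib_left)
      also have "\<dots> = d" using pos by simp
      finally show ?thesis .
    qed
    then show ?thesis
      using d by (intro exI[of _ "d / (norm a + norm b + 1)"]) (auto simp: dist_real_def add_nonneg_pos)
  qed
  have "A x h \<bullet> k = A x k \<bullet> h"
  proof (rule ccontr)
    assume ne: "A x h \<bullet> k \<noteq> A x k \<bullet> h"
    define e where "e = \<bar>A x h \<bullet> k - A x k \<bullet> h\<bar> / 2"
    have e: "e > 0" using ne by (simp add: e_def)
    obtain d1 where d1: "d1 > 0" "\<And>r s. 0 < r \<Longrightarrow> r < d1 \<Longrightarrow> 0 < s \<Longrightarrow> s < d1 \<Longrightarrow>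
      \<bar>A (x + r *\<^sub>R k + s *\<^sub>R h) h \<bullet> k - A x h \<bullet> k\<bar> < e"
      using near[OF e] by blast
    obtain d2 where d2: "d2 > 0" "\<And>r s. 0 < r \<Longrightarrow> r < d2 \<Longrightarrow> 0 < s \<Longrightarrow> s < d2 \<Longrightarrow>
      \<bar>A (x + r *\<^sub>R h + s *\<^sub>R k) k \<bullet> h - A x k \<bullet> h\<bar> < e"
      using near[OF e] by blast
    define t where "t = min d1 d2"
    have t: "t > 0" "t \<le> d1" "t \<le> d2" using d1 d2 by (auto simp: t_def)
    obtain r s where rs: "0 < r" "r < t" "0 < s" "s < t"
      and 1: "\<psi> (x + t *\<^sub>R k + t *\<^sub>R h) - \<psi> (x + t *\<^sub>R k) - \<psi> (x + t *\<^sub>R h) + \<psi> x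
        = t\<^sup>2 * (A (x + r *\<^sub>R k + s *\<^sub>R h) h \<bullet> k)"
      using second_difference[OF t(1)] by blast
    obtain r' s' where rs': "0 < r'" "r' < t" "0 < s'" "s' < t"
      and 2: "\<psi> (x + t *\<^sub>R h + t *\<^sub>R k) - \<psi> (x + t *\<^sub>R h) - \<psi> (x + t *\<^sub>R k) + \<psi> x
        = t\<^sup>2 * (A (x + r' *\<^sub>R h + s' *\<^sub>R k) k \<bullet> h)"
      using second_difference[OF t(1)] by blast
    have "t\<^sup>2 * (A (x + r *\<^sub>R k + s *\<^sub>R h) h \<bullet> k) = t\<^sup>2 * (A (x + r' *\<^sub>R h + s' *\<^sub>R k) k \<bullet> h)"
      using 1 2 by (simp add: algebra_simps)
    then have "A (x + r *\<^sub>R k + s *\<^sub>R h) h \<bullet> k = A (x + r' *\<^sub>R h + s' *\<^sub>R k) k \<bullet> h"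
      using t by simp
    moreover have "\<bar>A (x + r *\<^sub>R k + s *\<^sub>R h) h \<bullet> k - A x h \<bullet> k\<bar> < e"
      using rs t by (intro d1) auto
    moreover have "\<bar>A (x + r' *\<^sub>R h + s' *\<^sub>R k) k \<bullet> h - A x k \<bullet> h\<bar> < e"
      using rs' t by (intro d2) auto
    ultimately show False unfolding e_def by argo
  qed
  then show ?thesis by (simp add: inner_commute)
qed

lemma gradient_eq:
  fixes f :: "'a::real_inner \<Rightarrow> real"
  assumes "(f has_derivative (\<lambda>h. g \<bullet> h)) (at x)"
  shows "gradient f x = g"
  unfolding gradient_def
proof (rule the_equality)
  show "GDERIV f x :> g"
    using assms by (simp add: gderiv_def inner_commute)
next
  fix g' assume "GDERIV f x :> g'"
  then have "(\<lambda>h. g \<bullet> h) = (\<lambda>h. h \<bullet> g')"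
    using has_derivative_unique[OF assms] by (simp add: gderiv_def)
  then have "(g - g') \<bullet> (g - g') = 0"
    by (metis (no_types) inner_commute inner_diff_left right_minus_eq)
  then show "g' = g" by simp
qed

text \<open>
  The sum of the two tangent inequalities, at \<open>x\<close> and at \<open>y\<close>.
\<close>

lemma convex_gradient_monotone:
  fixes f :: "'a::real_inner \<Rightarrow> real"
  assumes convex: "convex_on UNIV f"
    and deriv: "\<And>x. (f has_derivative (\<lambda>h. g x \<bullet> h)) (at x)"
  shows "0 \<le> (x - y) \<bullet> (g x - g y)"
proof -
  have tangent: "g x \<bullet> (y - x) \<le> f y - f x" for x y
  proof -
    define \<phi> where "\<phi> s = f (x + s *\<^sub>R (y - x))" for s
    have "convex_on UNIV \<phi>"
    proof (rule convex_onI)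
      fix t a b :: real assume t: "0 < t" "t < 1"
      have "x + ((1 - t) * a + t * b) *\<^sub>R (y - x)
          = (1 - t) *\<^sub>R (x + a *\<^sub>R (y - x)) + t *\<^sub>R (x + b *\<^sub>R (y - x))"
        by (simp add: algebra_simps)
      then show "\<phi> ((1 - t) *\<^sub>R a + t *\<^sub>R b) \<le> (1 - t) * \<phi> a + t * \<phi> b"
        using convex_onD[OF convex, of t] t by (simp add: \<phi>_def)
    qed simp
    moreover have "(\<phi> has_real_derivative g x \<bullet> (y - x)) (at 0)"
      unfolding \<phi>_def using deriv[of x] by (intro has_real_derivative_along_line) simp
    ultimately show ?thesis
      using convex_on_imp_above_tangent[of UNIV \<phi> 0 1 "g x \<bullet> (y - x)"] by (simp add: \<phi>_def)
  qed
  from tangent[of x y] tangent[of y x] show ?thesis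
    by (simp add: inner_diff_left inner_diff_right inner_commute)
qed

section \<open>Global integral curves of continuously differentiable vector fields\<close>

definition integral_curve :: "('a::real_normed_vector \<Rightarrow> 'a) \<Rightarrow> real \<Rightarrow> (real \<Rightarrow> 'a) \<Rightarrow> bool" where
  "integral_curve G T u \<longleftrightarrow>
     (\<forall>t\<in>{0..T}. (u has_vector_derivative G (u t)) (at t within {0..T}))"

lemma integral_curve_continuous_on:
  "integral_curve G T u \<Longrightarrow> continuous_on {0..T} u"
  unfolding integral_curve_def continuous_on_eq_continuous_within
  by (blast intro: has_vector_derivative_continuous)

lemma integral_curve_restrict:
  "integral_curve G T u \<Longrightarrow> S \<le> T \<Longrightarrow> integral_curve G S u"
  unfolding integral_curve_def
  by (auto intro: has_vector_derivative_within_subset[of _ _ _ "{0..T}" "{0..S}"])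

lemma integral_curve_interior:
  "integral_curve G T u \<Longrightarrow> 0 < t \<Longrightarrow> t < T \<Longrightarrow> (u has_vector_derivative G (u t)) (at t)"
  unfolding integral_curve_def
  by (metis at_within_Icc_at atLeastAtMost_iff less_eq_real_def)

lemma integral_curve_append:
  assumes u: "integral_curve G a u" and w: "integral_curve G b w"
    and ab: "0 \<le> a" "0 \<le> b" and eq: "u a = w 0"
  shows "integral_curve G (a + b) (\<lambda>t. if t \<in> {0..a} then u t else w (t - a))"
  unfolding integral_curve_def
proof
  fix t assume t: "t \<in> {0..a + b}"
  have shift: "((\<lambda>s. w (s - a)) has_vector_derivative G (w (s - a))) (at s within {a..a + b})"
    if "s \<in> {a..a + b}" for s
  proof -
    have img: "(\<lambda>s. s - a) ` {a..a + b} = {0..b}" by simp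
    have "((\<lambda>s. s - a) has_vector_derivative 1) (at s within {a..a + b})"
      by (auto intro!: derivative_eq_intros)
    from vector_diff_chain_within[OF this, of w "G (w (s - a))"] w that show ?thesis
      unfolding img integral_curve_def by (auto simp: o_def)
  qed
  have "((\<lambda>t. if t \<in> {0..a} then u t else w (t - a)) has_vector_derivative
      (if t \<in> {0..a} then G (u t) else G (w (t - a)))) (at t within {0..a + b})"
  proof (rule has_vector_derivative_If_within_closures[where T = "{a..a + b}"])
    show "t \<in> {0..a} \<union> {a..a + b}" "{0..a + b} = {0..a} \<union> {a..a + b}"
      using t ab by auto
    have s1: "{0..a} \<union> closure {0..a} \<inter> closure {a..a + b} = {0..a}"
      and s2: "{a..a + b} \<union> closure {0..a} \<inter> closure {a..a + b} = {a..a + b}"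
      using ab by auto
    show "(u has_vector_derivative G (u t)) (at t within {0..a} \<union> closure {0..a} \<inter> closure {a..a + b})"
      if "t \<in> {0..a} \<union> closure {0..a} \<inter> closure {a..a + b}"
      using u that unfolding s1 integral_curve_def by blast
    show "((\<lambda>t. w (t - a)) has_vector_derivative G (w (t - a)))
        (at t within {a..a + b} \<union> closure {0..a} \<inter> closure {a..a + b})"
      if "t \<in> {a..a + b} \<union> closure {0..a} \<inter> closure {a..a + b}"
      using shift that unfolding s2 by blast
    show "u t = w (t - a)" "G (u t) = G (w (t - a))"
      if "t \<in> closure {0..a}" "t \<in> closure {a..a + b}"
    proof -
      have "t = a" using that by simp
      then show "u t = w (t - a)" "G (u t) = G (w (t - a))" using eq by simp_all
    qed
  qed
  then show "((\<lambda>t. if t \<in> {0..a} then u t else w (t - a)) has_vector_derivative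
      G (if t \<in> {0..a} then u t else w (t - a))) (at t within {0..a + b})"
    by (simp add: if_distrib[of G] cong: if_cong)
qed

locale C1_vector_field =
  fixes G :: "'a::{real_inner, banach} \<Rightarrow> 'a" and B :: "'a \<Rightarrow> 'a \<Rightarrow>\<^sub>L 'a"
  assumes G_deriv: "\<And>x. (G has_derivative blinfun_apply (B x)) (at x)"
    and B_cont: "continuous_on UNIV B"
begin

lemma G_cont: "continuous_on S G"
  using G_deriv by (meson continuous_at_imp_continuous_on has_derivative_continuous)

lemma lipschitz_on_convex:
  assumes "convex S" "\<And>x. x \<in> S \<Longrightarrow> norm (B x) \<le> L" "x \<in> S" "y \<in> S"
  shows "norm (G x - G y) \<le> L * norm (x - y)"
proof (rule differentiable_bound[OF assms(1)])
  show "(G has_derivative blinfun_apply (B z)) (at z within S)" for z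
    by (rule has_derivative_at_withinI[OF G_deriv])
  show "onorm (blinfun_apply (B z)) \<le> L" if "z \<in> S" for z
    using assms(2)[OF that] by (simp add: norm_blinfun.rep_eq)
qed (fact assms)+

text \<open>
  The existence time \<open>h\<close> is the same for all starting points near \<open>l\<close>. This uniformity lets a
  curve be continued past a finite limit time without first being extended to that time.
\<close>

lemma local_existence_uniform:
  "\<exists>\<delta>>0. \<exists>h>0. \<forall>x\<in>cball l \<delta>. \<exists>u. integral_curve G h u \<and> u 0 = x"
proof -
  define L where "L = norm (B l) + 1"
  have L: "L \<ge> 1" by (simp add: L_def)
  have "isCont B l" using B_cont by (simp add: continuous_on_eq_continuous_at)
  then obtain r0 where r0: "r0 > 0" "\<And>y. dist y l < r0 \<Longrightarrow> dist (B y) (B l) < 1"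
    unfolding continuous_at_eps_delta by (metis zero_less_one)
  define r where "r = r0 / 2"
  have r: "r > 0" using r0 by (simp add: r_def)
  have B_bound: "norm (B y) \<le> L" if "y \<in> cball l r" for y
  proof -
    have "dist y l < r0" using that r0(1) by (simp add: r_def dist_commute)
    then have "norm (B y - B l) < 1" using r0 by (simp add: dist_norm)
    then show ?thesis using norm_triangle_ineq2[of "B y" "B l"] by (simp add: L_def)
  qed
  have lip: "norm (G y - G z) \<le> L * norm (y - z)" if "y \<in> cball l r" "z \<in> cball l r" for y z
    by (rule lipschitz_on_convex[of "cball l r"]) (use that B_bound in auto)
  define M where "M = norm (G l) + L * r"
  have M: "M \<ge> 0" using L r by (simp add: M_def)
  have G_bound: "norm (G y) \<le> M" if "y \<in> cball l r" for y
  proof -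
    have "norm (G y - G l) \<le> L * norm (y - l)" using lip that r by simp
    also have "\<dots> \<le> L * r" using that L by (intro mult_left_mono) (auto simp: dist_norm norm_minus_commute)
    finally show ?thesis using norm_triangle_ineq2[of "G y" "G l"] by (simp add: M_def)
  qed
  \<comment> \<open>The first bound keeps the curves in \<open>cball l r\<close>, the second makes the Picard operator a
    contraction.\<close>
  define h where "h = min (r / (2 * (M + 1))) (1 / (2 * L))"
  have h: "h > 0" using r M L by (simp add: h_def)
  have hL: "L * h \<le> 1 / 2"
  proof -
    have "L * h \<le> L * (1 / (2 * L))" unfolding h_def using L by (intro mult_left_mono) auto
    then show ?thesis using L by simp
  qed
  have hM: "M * h \<le> r / 2"
  proof -
    have "M * h \<le> (M + 1) * (r / (2 * (M + 1)))"
      unfolding h_def using M r L by (intro mult_mono) auto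
    also have "\<dots> = r / 2" using M by (simp add: divide_simps add_nonneg_pos)
    finally show ?thesis .
  qed
  have "\<exists>u. integral_curve G h u \<and> u 0 = x" if x: "x \<in> cball l (r / 2)" for x
  proof -
    \<comment> \<open>Freezing time outside \<open>{0..h}\<close> turns the Picard operator into a map of bounded continuous
      functions on the whole line, which form a complete metric space.\<close>
    define clamp where "clamp t = max 0 (min h t)" for t :: real
    have clamp: "clamp t \<in> {0..h}" for t using h by (auto simp: clamp_def)
    define \<Phi> where "\<Phi> u t = x + integral {0..clamp t} (\<lambda>s. G (u s))" for u t
    define X :: "(real \<Rightarrow>\<^sub>C 'a) set" where "X = PiC UNIV (\<lambda>_. cball l r)"
    have X_D: "apply_bcontfun u t \<in> cball l r" if "u \<in> X" for u t
      using that by (auto simp: X_def mem_PiC_iff)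
    have cont_Gu: "continuous_on S (\<lambda>s. G (apply_bcontfun u s))" for u :: "real \<Rightarrow>\<^sub>C 'a" and S
      by (rule continuous_on_compose2[OF G_cont[of UNIV] continuous_on_apply_bcontfun]) auto
    have \<Phi>_in: "\<Phi> (apply_bcontfun u) t \<in> cball l r" if "u \<in> X" for u t
    proof -
      have "norm (integral {0..clamp t} (\<lambda>s. G (apply_bcontfun u s))) \<le> M * (clamp t - 0)"
        using clamp[of t] by (intro integral_bound cont_Gu G_bound X_D that) auto
      also have "\<dots> \<le> M * h" using clamp[of t] M by (intro mult_left_mono) auto
      also have "\<dots> \<le> r / 2" by (rule hM)
      finally have "dist (\<Phi> (apply_bcontfun u) t) x \<le> r / 2" by (simp add: \<Phi>_def dist_norm)
      with x show ?thesis
        using dist_triangle[of l "\<Phi> (apply_bcontfun u) t" x] by (simp add: dist_commute)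
    qed
    have \<Phi>_cont: "\<Phi> (apply_bcontfun u) \<in> bcontfun" if "u \<in> X" for u
    proof -
      have "continuous_on UNIV (\<lambda>t. integral {0..clamp t} (\<lambda>s. G (apply_bcontfun u s)))"
      proof (rule continuous_on_compose2[of "{0..h}" _ _ clamp])
        show "continuous_on {0..h} (\<lambda>t. integral {0..t} (\<lambda>s. G (apply_bcontfun u s)))"
          by (intro indefinite_integral_continuous_1 integrable_continuous_real cont_Gu)
        show "continuous_on UNIV clamp" unfolding clamp_def by (intro continuous_intros)
      qed (use clamp in auto)
      then have "continuous_on UNIV (\<Phi> (apply_bcontfun u))"
        unfolding \<Phi>_def by (intro continuous_intros)
      moreover have "bounded (range (\<Phi> (apply_bcontfun u)))"
        using \<Phi>_in[OF that] by (intro bounded_subset[OF bounded_cball[of l r]]) auto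
      ultimately show ?thesis by (simp add: bcontfun_def)
    qed
    define P where "P u = Bcontfun (\<Phi> (apply_bcontfun u))" for u
    have P: "apply_bcontfun (P u) = \<Phi> (apply_bcontfun u)" if "u \<in> X" for u
      unfolding P_def using \<Phi>_cont[OF that] by (rule Bcontfun_inverse)
    have "\<exists>!u\<in>X. P u = u"
    proof (rule Banach_fix)
      show "complete X"
        unfolding X_def by (intro closed_PiC[THEN complete_eq_closed[THEN iffD2]]) auto
      have "const_bcontfun l \<in> X" using r by (simp add: X_def mem_PiC_iff const_bcontfun.rep_eq)
      then show "X \<noteq> {}" by blast
      show "P ` X \<subseteq> X"
      proof
        fix w assume "w \<in> P ` X"
        then obtain u where "u \<in> X" "w = P u" by blast
        then show "w \<in> X" using P \<Phi>_in by (simp add: X_def mem_PiC_iff Pi_def)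
      qed
      show "dist (P u) (P w) \<le> 1 / 2 * dist u w" if uw: "u \<in> X" "w \<in> X" for u w
      proof (rule dist_bound)
        fix t
        have "dist (P u t) (P w t)
            = norm (integral {0..clamp t} (\<lambda>s. G (apply_bcontfun u s)) - integral {0..clamp t} (\<lambda>s. G (apply_bcontfun w s)))"
          by (simp add: P uw \<Phi>_def dist_norm)
        also have "\<dots> = norm (integral {0..clamp t} (\<lambda>s. G (apply_bcontfun u s) - G (apply_bcontfun w s)))"
          by (subst integral_diff) (auto intro!: integrable_continuous_real cont_Gu)
        also have "\<dots> \<le> (L * dist u w) * (clamp t - 0)"
        proof (rule integral_bound)
          show "continuous_on {0..clamp t} (\<lambda>s. G (apply_bcontfun u s) - G (apply_bcontfun w s))"
            by (intro continuous_intros cont_Gu)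
          fix s
          have "norm (G (apply_bcontfun u s) - G (apply_bcontfun w s)) \<le> L * norm (apply_bcontfun u s - apply_bcontfun w s)"
            by (intro lip X_D uw)
          also have "\<dots> \<le> L * dist u w"
            using L dist_bounded[of u s w] by (intro mult_left_mono) (auto simp: dist_norm)
          finally show "norm (G (apply_bcontfun u s) - G (apply_bcontfun w s)) \<le> L * dist u w" .
        qed (use clamp in auto)
        also have "\<dots> \<le> (L * dist u w) * h"
          using clamp[of t] L by (intro mult_left_mono) auto
        also have "\<dots> = (L * h) * dist u w" by simp
        also have "\<dots> \<le> 1 / 2 * dist u w"
          using hL by (intro mult_right_mono) auto
        finally show "dist (P u t) (P w t) \<le> 1 / 2 * dist u w" .
      qed
    qed auto
    then obtain u where u: "u \<in> X" "P u = u" by blast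
    have u_eq: "apply_bcontfun u t = x + integral {0..t} (\<lambda>s. G (apply_bcontfun u s))" if "t \<in> {0..h}" for t
    proof -
      have "clamp t = t" using that by (simp add: clamp_def)
      then show ?thesis using P[OF u(1)] u(2) unfolding \<Phi>_def by metis
    qed
    have "integral_curve G h (apply_bcontfun u)"
      unfolding integral_curve_def
    proof
      fix t assume t: "t \<in> {0..h}"
      have "((\<lambda>t. x + integral {0..t} (\<lambda>s. G (apply_bcontfun u s))) has_vector_derivative 0 + G (apply_bcontfun u t))
          (at t within {0..h})"
        by (intro derivative_intros integral_has_vector_derivative cont_Gu t)
      then have "((\<lambda>t. x + integral {0..t} (\<lambda>s. G (apply_bcontfun u s))) has_vector_derivative G (apply_bcontfun u t))
          (at t within {0..h})" by simp
      then show "(apply_bcontfun u has_vector_derivative G (apply_bcontfun u t)) (at t within {0..h})"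
        by (rule has_vector_derivative_transform[OF t, rotated]) (simp add: u_eq)
    qed
    moreover have "apply_bcontfun u 0 = x" using u_eq[of 0] h by simp
    ultimately show ?thesis by blast
  qed
  then have "\<exists>h>0. \<forall>x\<in>cball l (r / 2). \<exists>u. integral_curve G h u \<and> u 0 = x"
    using h by blast
  then show ?thesis using half_gt_zero[OF r] by blast
qed

text \<open>
  The segments joining \<open>u t\<close> to \<open>w t\<close> sweep out a compact set, so one Lipschitz constant
  serves all times, although \<open>G\<close> is only locally Lipschitz.
\<close>

lemma integral_curve_unique:
  assumes u: "integral_curve G T u" and w: "integral_curve G T w" and eq: "u 0 = w 0"
    and t: "t \<in> {0..T}"
  shows "u t = w t"
proof -
  define K where "K = (\<lambda>(s, t). (1 - s) *\<^sub>R u t + s *\<^sub>R w t) ` ({0..1} \<times> {0..T})"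
  have cont_snd: "continuous_on ({0..1::real} \<times> {0..T}) (\<lambda>p. u (snd p))"
    "continuous_on ({0..1::real} \<times> {0..T}) (\<lambda>p. w (snd p))"
    by (rule continuous_on_compose2[OF integral_curve_continuous_on[OF u] continuous_on_snd[OF continuous_on_id]], force)
      (rule continuous_on_compose2[OF integral_curve_continuous_on[OF w] continuous_on_snd[OF continuous_on_id]], force)
  have "compact K"
    unfolding K_def case_prod_beta
    by (intro compact_continuous_image compact_Times compact_Icc continuous_intros cont_snd)
  then have "compact (B ` K)"
    by (rule compact_continuous_image[rotated]) (rule continuous_on_subset[OF B_cont], simp)
  then obtain L where L: "\<And>y. y \<in> K \<Longrightarrow> norm (B y) \<le> L"
    using compact_imp_bounded[of "B ` K"] unfolding bounded_iff by blast
  have lip: "norm (G (u s) - G (w s)) \<le> L * norm (u s - w s)" if "s \<in> {0..T}" for s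
  proof (rule lipschitz_on_convex[of "closed_segment (u s) (w s)"])
    fix y assume "y \<in> closed_segment (u s) (w s)"
    then have "y \<in> K" using that by (force simp: K_def closed_segment_def)
    then show "norm (B y) \<le> L" by (rule L)
  qed auto
  \<comment> \<open>Gronwall: the exponential weight absorbs the growth allowed by the Lipschitz constant.\<close>
  define q where "q s = exp (- 2 * L * s) * ((u s - w s) \<bullet> (u s - w s))" for s
  have "q t \<le> q 0"
  proof (rule DERIV_nonpos_imp_decreasing_open[of 0 t q])
    show "0 \<le> t" using t by simp
    have "continuous_on {0..t} u" "continuous_on {0..t} w"
      using t integral_curve_continuous_on[OF u] integral_curve_continuous_on[OF w]
      by (auto intro: continuous_on_subset)
    then show "continuous_on {0..t} q"
      unfolding q_def by (intro continuous_intros)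
    fix s assume s: "0 < s" "s < t"
    have du: "(u has_vector_derivative G (u s)) (at s)" and dw: "(w has_vector_derivative G (w s)) (at s)"
      using integral_curve_interior[OF u, of s] integral_curve_interior[OF w, of s] s t by auto
    define D where "D = - 2 * L * exp (- 2 * L * s) * ((u s - w s) \<bullet> (u s - w s)) +
      exp (- 2 * L * s) * (2 * ((u s - w s) \<bullet> (G (u s) - G (w s))))"
    have "(q has_real_derivative D) (at s)"
      using du dw unfolding q_def D_def has_vector_derivative_def has_field_derivative_def
      by (auto intro!: derivative_eq_intros simp: fun_eq_iff algebra_simps inner_commute)
    moreover have "D \<le> 0"
    proof -
      have "(u s - w s) \<bullet> (G (u s) - G (w s)) \<le> norm (u s - w s) * norm (G (u s) - G (w s))"
        by (rule norm_cauchy_schwarz)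
      also have "\<dots> \<le> norm (u s - w s) * (L * norm (u s - w s))"
        using lip[of s] s t by (intro mult_left_mono) auto
      also have "\<dots> = L * ((u s - w s) \<bullet> (u s - w s))"
        by (simp add: dot_square_norm power2_eq_square)
      finally have "exp (- 2 * L * s) * ((u s - w s) \<bullet> (G (u s) - G (w s)))
          \<le> exp (- 2 * L * s) * (L * ((u s - w s) \<bullet> (u s - w s)))"
        by (intro mult_left_mono) auto
      then show ?thesis unfolding D_def by simp
    qed
    ultimately show "\<exists>y. (q has_real_derivative y) (at s) \<and> y \<le> 0" by blast
  qed
  then have "exp (- 2 * L * t) * ((u t - w t) \<bullet> (u t - w t)) \<le> 0" by (simp add: q_def eq)
  then show ?thesis by (simp add: mult_le_0_iff dot_square_norm)
qed

text \<open>
  The hypothesis gives a limit of the curve at a finite maximal time; local existence near this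
  limit continues the curve beyond it.
\<close>

lemma global_integral_curve:
  assumes holder: "\<And>T u s t. integral_curve G T u \<Longrightarrow> u 0 = x0 \<Longrightarrow> 0 \<le> s \<Longrightarrow> s \<le> t \<Longrightarrow> t \<le> T \<Longrightarrow>
    (norm (u t - u s))\<^sup>2 \<le> C * (t - s)"
  shows "\<exists>u. u 0 = x0 \<and> (\<forall>T. integral_curve G T u)"
proof -
  define E where "E = {T. T \<ge> 0 \<and> (\<exists>u. integral_curve G T u \<and> u 0 = x0)}"
  have E_down: "s \<in> E" if T: "T \<in> E" and s: "0 \<le> s" "s \<le> T" for s T
  proof -
    obtain u where "integral_curve G T u" "u 0 = x0" using T by (auto simp: E_def)
    then have "integral_curve G s u" using integral_curve_restrict s(2) by blast
    then show ?thesis using s(1) \<open>u 0 = x0\<close> by (auto simp: E_def)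
  qed
  have "\<forall>T\<in>E. \<exists>u. integral_curve G T u \<and> u 0 = x0"
    unfolding E_def by blast
  then obtain y where y: "\<And>T. T \<in> E \<Longrightarrow> integral_curve G T (y T) \<and> y T 0 = x0"
    using bchoice[of E "\<lambda>T u. integral_curve G T u \<and> u 0 = x0"] by blast
  have y_eq: "y S t = y T t" if "S \<in> E" "T \<in> E" "t \<in> {0..S}" "t \<in> {0..T}" for S T t
  proof (rule integral_curve_unique[of "min S T"])
    show "integral_curve G (min S T) (y S)"
      using y[OF that(1)] by (blast intro: integral_curve_restrict min.cobounded1)
    show "integral_curve G (min S T) (y T)"
      using y[OF that(2)] by (blast intro: integral_curve_restrict min.cobounded2)
  qed (use that y in auto)
  obtain \<delta>0 h0 where h0: "\<delta>0 > 0" "h0 > 0" "\<And>x. x \<in> cball x0 \<delta>0 \<Longrightarrow> \<exists>u. integral_curve G h0 u \<and> u 0 = x"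
    using local_existence_uniform[of x0] by blast
  then have h0_E: "h0 \<in> E" unfolding E_def by (simp add: less_imp_le)
  have unbounded: "T \<in> E" if "T \<ge> 0" for T
  proof (rule ccontr)
    assume T: "T \<notin> E"
    have E_less: "S < T" if "S \<in> E" for S
      using E_down[OF that \<open>T \<ge> 0\<close>] T by fastforce
    have bdd: "bdd_above E" using E_less by (meson bdd_above.I less_imp_le)
    define \<tau> where "\<tau> = Sup E"
    have \<tau>_ge: "S \<le> \<tau>" if "S \<in> E" for S
      unfolding \<tau>_def by (rule cSup_upper[OF that bdd])
    have \<tau>: "\<tau> > 0" using \<tau>_ge[OF h0_E] h0 by linarith
    have below: "S \<in> E" if S: "0 \<le> S" "S < \<tau>" for S
    proof -
      obtain S' where "S' \<in> E" "S < S'"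
        using less_cSupD[of E S] S h0_E unfolding \<tau>_def by blast
      then show ?thesis using E_down S by (meson less_imp_le)
    qed
    \<comment> \<open>Times increasing to \<open>\<tau>\<close>; the positions \<open>z n\<close> at these times converge.\<close>
    define a where "a n = \<tau> - \<tau> * inverse (real (Suc n))" for n :: nat
    have a: "0 \<le> a n" "a n < \<tau>" for n
      using \<tau> by (auto simp: a_def field_simps)
    have a_mono: "a m \<le> a n" if "m \<le> n" for m n
      using that \<tau> unfolding a_def by (intro diff_left_mono mult_left_mono le_imp_inverse_le) auto
    have a_lim: "a \<longlonglongrightarrow> \<tau>"
      unfolding a_def using tendsto_diff[OF tendsto_const tendsto_mult[OF tendsto_const LIMSEQ_inverse_real_of_nat]]
      by simp
    define z where "z n = y (a n) (a n)" for n
    have z_dist: "(norm (z n - z m))\<^sup>2 \<le> C * (a n - a m)" if "m \<le> n" for m n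
    proof -
      have z_m: "z m = y (a n) (a m)"
        unfolding z_def using a a_mono[OF that] by (intro y_eq below) auto
      have "(norm (y (a n) (a n) - y (a n) (a m)))\<^sup>2 \<le> C * (a n - a m)"
        using y[OF below[OF a], of n] a a_mono[OF that] by (intro holder[of "a n" "y (a n)"]) auto
      then show ?thesis by (simp add: z_m) (simp add: z_def)
    qed
    have "Cauchy z"
    proof (rule metric_CauchyI)
      fix e :: real assume e: "e > 0"
      have "Cauchy a" using a_lim by (rule LIMSEQ_imp_Cauchy)
      then obtain N where N: "\<And>m n. m \<ge> N \<Longrightarrow> n \<ge> N \<Longrightarrow> dist (a m) (a n) < e\<^sup>2 / (\<bar>C\<bar> + 1)"
        using e metric_CauchyD[of a "e\<^sup>2 / (\<bar>C\<bar> + 1)"] by force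
      have close: "dist (z n) (z m) < e" if "N \<le> m" "m \<le> n" for m n
      proof -
        have "(norm (z n - z m))\<^sup>2 \<le> C * (a n - a m)" by (rule z_dist[OF that(2)])
        also have "\<dots> \<le> (\<bar>C\<bar> + 1) * (a n - a m)"
          using a_mono[OF that(2)] by (intro mult_right_mono) auto
        also have "\<dots> < (\<bar>C\<bar> + 1) * (e\<^sup>2 / (\<bar>C\<bar> + 1))"
          using N[of n m] that by (intro mult_strict_left_mono) (auto simp: dist_real_def)
        also have "\<dots> = e\<^sup>2" by simp
        finally show ?thesis using e by (simp add: dist_norm power_less_imp_less_base)
      qed
      have "dist (z m) (z n) < e" if "N \<le> m" "N \<le> n" for m n
        using close[of m n] close[of n m] that by (cases "m \<le> n") (auto simp: dist_commute)
      then show "\<exists>M. \<forall>m\<ge>M. \<forall>n\<ge>M. dist (z m) (z n) < e" by blast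
    qed
    then obtain l where l: "z \<longlonglongrightarrow> l"
      using Cauchy_convergent_iff convergent_def by blast
    obtain \<delta> h where h: "\<delta> > 0" "h > 0" "\<And>x. x \<in> cball l \<delta> \<Longrightarrow> \<exists>u. integral_curve G h u \<and> u 0 = x"
      using local_existence_uniform[of l] by blast
    have "eventually (\<lambda>n. dist (z n) l < \<delta>) sequentially" "eventually (\<lambda>n. dist (a n) \<tau> < h) sequentially"
      using tendstoD[OF l h(1)] tendstoD[OF a_lim h(2)] .
    then have "eventually (\<lambda>n. dist (z n) l < \<delta> \<and> dist (a n) \<tau> < h) sequentially"
      by (rule eventually_conj)
    then obtain n where n: "dist (z n) l < \<delta>" "dist (a n) \<tau> < h"
      by (auto simp: eventually_sequentially)
    then obtain w where w: "integral_curve G h w" "w 0 = z n"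
      using h(3)[of "z n"] by (auto simp: dist_commute)
    have ya: "integral_curve G (a n) (y (a n))" "y (a n) 0 = x0"
      using y[OF below[OF a]] by auto
    have "integral_curve G (a n + h) (\<lambda>t. if t \<in> {0..a n} then y (a n) t else w (t - a n))"
      using ya w a[of n] h by (intro integral_curve_append) (auto simp: z_def)
    moreover have "(\<lambda>t. if t \<in> {0..a n} then y (a n) t else w (t - a n)) 0 = x0"
      using ya(2) a[of n] by simp
    moreover have "0 \<le> a n + h" using a[of n] h by simp
    ultimately have "a n + h \<in> E" unfolding E_def by blast
    then have "a n + h \<le> \<tau>" by (rule \<tau>_ge)
    with n(2) a[of n] show False by (simp add: dist_real_def)
  qed
  define u where "u t = y (max t 0) t" for t
  have u_eq: "u t = y T t" if "0 \<le> t" "t \<le> T" for t T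
    unfolding u_def using that by (intro y_eq unbounded) auto
  have "integral_curve G T u" for T
    unfolding integral_curve_def
  proof
    fix t assume t: "t \<in> {0..T}"
    then have "(y T has_vector_derivative G (y T t)) (at t within {0..T})"
      using y[OF unbounded[of T]] unfolding integral_curve_def by auto
    then have "(u has_vector_derivative G (y T t)) (at t within {0..T})"
      by (rule has_vector_derivative_transform[OF t, rotated]) (auto simp: u_eq)
    then show "(u has_vector_derivative G (u t)) (at t within {0..T})"
      using t by (simp add: u_eq[of t T])
  qed
  moreover have "u 0 = x0" using u_eq[of 0 0] y[OF unbounded[of 0]] by simp
  ultimately show ?thesis by blast
qed

end

section \<open>Curves of finite energy\<close>

text \<open>
  This is the Cauchy-Schwarz inequality for \<open>u'\<close>, with a primitive \<open>E\<close> of a bound for \<open>(norm u')\<^sup>2\<close>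
  in place of an integral. It follows from \<open>2 * norm u' \<le> c + (norm u')\<^sup>2 / c\<close> with the choice
  \<open>c = norm (u t - u s) / (t - s)\<close>.
\<close>

lemma energy_displacement_bound:
  fixes u :: "real \<Rightarrow> 'a::real_normed_vector" and E :: "real \<Rightarrow> real"
  assumes "s \<le> t" and u_cont: "continuous_on {s..t} u" and E_cont: "continuous_on {s..t} E"
    and u': "\<And>r. s < r \<Longrightarrow> r < t \<Longrightarrow> (u has_vector_derivative u' r) (at r)"
    and E': "\<And>r. s < r \<Longrightarrow> r < t \<Longrightarrow> (E has_real_derivative e r) (at r)"
    and bound: "\<And>r. s < r \<Longrightarrow> r < t \<Longrightarrow> (norm (u' r))\<^sup>2 \<le> e r"
  shows "(norm (u t - u s))\<^sup>2 \<le> (t - s) * (E t - E s)"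
proof (cases "u t = u s")
  case True
  have "E s \<le> E t"
  proof (rule DERIV_nonneg_imp_increasing_open[of s t E])
    show "\<exists>y. (E has_real_derivative y) (at r) \<and> y \<ge> 0" if "s < r" "r < t" for r
      using E'[OF that] bound[OF that] order_trans[OF zero_le_power2] by blast
  qed (use assms in auto)
  then show ?thesis using True \<open>s \<le> t\<close> by simp
next
  case False
  define N where "N = norm (u t - u s)"
  have N: "N > 0" and st: "s < t"
    using False \<open>s \<le> t\<close> by (auto simp: N_def order.strict_iff_order)
  define c where "c = N / (t - s)"
  have c: "c > 0" using N st by (simp add: c_def)
  have "norm (u t - u s) \<le> (c / 2 * t + E t / (2 * c)) - (c / 2 * s + E s / (2 * c))"
  proof (rule differentiable_bound_general[OF st u_cont _ u'])
    show "continuous_on {s..t} (\<lambda>r. c / 2 * r + E r / (2 * c))"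
      using c by (intro continuous_intros E_cont) auto
    fix r assume r: "s < r" "r < t"
    have "((\<lambda>r. c / 2 * r + E r / (2 * c)) has_real_derivative c / 2 + e r / (2 * c)) (at r)"
      using c E'[OF r] by (auto intro!: derivative_eq_intros)
    then show "((\<lambda>r. c / 2 * r + E r / (2 * c)) has_vector_derivative c / 2 + e r / (2 * c)) (at r)"
      by (simp add: has_real_derivative_iff_has_vector_derivative)
    have "0 \<le> (norm (u' r) - c)\<^sup>2" by simp
    then have "2 * c * norm (u' r) \<le> c\<^sup>2 + e r"
      using bound[OF r] by (simp add: power2_diff algebra_simps)
    then show "norm (u' r) \<le> c / 2 + e r / (2 * c)"
      using c by (simp add: field_simps power2_eq_square)
  qed
  also have "\<dots> = c * (t - s) / 2 + (E t - E s) / (2 * c)"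
    by (simp add: algebra_simps diff_divide_distrib)
  also have "c * (t - s) = N" using st by (simp add: c_def)
  finally have "N \<le> (E t - E s) / c"
    using c by (simp add: N_def field_simps)
  then have "N * c \<le> E t - E s" using c by (simp add: field_simps)
  then have "(t - s) * (N * c) \<le> (t - s) * (E t - E s)"
    using st by (intro mult_left_mono) auto
  moreover have "(t - s) * (N * c) = N\<^sup>2" using st by (simp add: c_def power2_eq_square)
  ultimately show ?thesis by (simp add: N_def)
qed

lemma at_within_Icc_eq_at_within_Ici:
  fixes t :: real
  assumes "t < T"
  shows "at t within {0..T} = at t within {0..}"
  by (rule at_within_nhd[of _ "{..<T}"]) (use assms in auto)

lemma at_within_Ici_interior:
  fixes t :: real
  shows "0 < t \<Longrightarrow> at t within {0..} = at t"
  by (rule at_within_open_subset[of _ "{0<..}"]) auto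

text \<open>
  A bounded nondecreasing primitive has a limit at infinity, which is the value of the integral up
  to a constant.
\<close>

lemma set_integrable_atLeast_bounded_primitive:
  fixes f F :: "real \<Rightarrow> real"
  assumes deriv: "\<And>t. 0 \<le> t \<Longrightarrow> (F has_real_derivative f t) (at t within {0..})"
    and cont: "continuous_on {0..} f" and nonneg: "\<And>t. 0 \<le> t \<Longrightarrow> 0 \<le> f t"
    and bound: "\<And>t. 0 \<le> t \<Longrightarrow> F t \<le> K"
  shows "set_integrable lborel {0..} f"
proof -
  have F_cont: "continuous_on {0..} F"
    using deriv by (auto intro: DERIV_continuous_on)
  have mono: "F s \<le> F t" if "0 \<le> s" "s \<le> t" for s t
  proof (rule DERIV_nonneg_imp_increasing_open[OF that(2)])
    show "\<exists>y. (F has_real_derivative y) (at r) \<and> y \<ge> 0" if "s < r" "r < t" for r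
      using deriv[of r] nonneg[of r] at_within_Ici_interior[of r] that \<open>0 \<le> s\<close> by auto
    show "continuous_on {s..t} F"
      using that by (intro continuous_on_subset[OF F_cont]) auto
  qed
  define L where "L = (SUP t\<in>{0..}. F t)"
  have bdd: "bdd_above (F ` {0..})" by (rule bdd_aboveI2[of _ _ K]) (simp add: bound)
  have F_lim: "(F \<longlongrightarrow> L) at_top"
  proof (rule order_tendstoI)
    fix a assume "a < L"
    then obtain s where s: "0 \<le> s" "a < F s"
      unfolding L_def using less_cSUP_iff[OF _ bdd, of a] by auto
    then have "\<forall>t\<ge>s. a < F t" using mono by (meson less_le_trans)
    then show "eventually (\<lambda>t. a < F t) at_top" unfolding eventually_at_top_linorder by blast
  next
    fix a assume "L < a"
    then have "\<forall>t\<ge>0. F t < a"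
      unfolding L_def using cSUP_upper[OF _ bdd] by (auto intro: le_less_trans)
    then show "eventually (\<lambda>t. F t < a) at_top" unfolding eventually_at_top_linorder by blast
  qed
  have F_0: "(F \<longlongrightarrow> F 0) (at_right 0)"
  proof -
    have "(F \<longlongrightarrow> F 0) (at 0 within {0..})"
      using F_cont by (simp add: continuous_on_def)
    then show ?thesis by (rule tendsto_within_subset) auto
  qed
  have "set_integrable lborel (einterval 0 \<infinity>) f"
  proof (rule interval_integral_FTC_nonneg(1)[of 0 \<infinity> F f "F 0" L])
    show "(F has_real_derivative f x) (at x)" if "0 < ereal x" for x
      using deriv[of x] at_within_Ici_interior[of x] that by simp
    show "isCont f x" if "0 < ereal x" for x
    proof -
      have x: "0 < x" using that by (simp add: zero_ereal_def)
      then have "continuous (at x within {0..}) f"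
        using cont by (simp add: continuous_on_eq_continuous_within)
      then show ?thesis by (simp add: at_within_Ici_interior[OF x])
    qed
    show "((F \<circ> real_of_ereal) \<longlongrightarrow> F 0) (at_right 0)"
      using F_0 by (simp add: zero_ereal_def ereal_tendsto_simps)
    show "((F \<circ> real_of_ereal) \<longlongrightarrow> L) (at_left \<infinity>)"
      using F_lim by (simp add: ereal_tendsto_simps)
    show "AE x in lborel. 0 < ereal x \<longrightarrow> ereal x < \<infinity> \<longrightarrow> 0 \<le> f x"
      using nonneg by (intro AE_I2) (auto simp: zero_ereal_def)
  qed auto
  moreover have "einterval 0 \<infinity> = {0<..}" by (auto simp: einterval_def zero_ereal_def)
  ultimately have "set_integrable lborel {0<..} f" by simp
  moreover have "set_integrable lborel {0} f"
    by (intro borel_integrable_compact[of "{0}" f, folded set_integrable_def]) auto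
  ultimately have "set_integrable lborel ({0} \<union> {0<..}) f"
    by (intro set_integrable_Un) auto
  moreover have "{0} \<union> {0<..} = {0::real..}" by auto
  ultimately show ?thesis by simp
qed

lemma set_integrable_atLeast_primitive:
  fixes f :: "real \<Rightarrow> real"
  assumes int: "set_integrable lborel {0..} f" and cont: "continuous_on {0..} f"
    and nonneg: "\<And>t. 0 \<le> t \<Longrightarrow> 0 \<le> f t"
  obtains F K where "\<And>t. 0 < t \<Longrightarrow> (F has_real_derivative f t) (at t)"
    and "continuous_on {0..} F" and "\<And>t. 0 \<le> t \<Longrightarrow> F t \<le> K"
proof
  let ?F = "\<lambda>t. integral {0..t} f"
  have cont_T: "continuous_on {0..T} f" for T
    by (rule continuous_on_subset[OF cont]) auto
  have deriv: "(?F has_real_derivative f t) (at t within {0..})" if "0 \<le> t" for t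
    using integral_has_real_derivative[OF cont_T[of "t + 1"], of t] that
    by (simp add: at_within_Icc_eq_at_within_Ici)
  show "(?F has_real_derivative f t) (at t)" if "0 < t" for t
    using deriv[of t] that at_within_Ici_interior[of t] by simp
  show "continuous_on {0..} ?F"
    using deriv by (auto intro: DERIV_continuous_on)
  have f_int: "f integrable_on {0..}"
    using set_borel_integral_eq_integral(1)[OF int] .
  show "?F t \<le> integral {0..} f" if "0 \<le> t" for t
    using nonneg by (intro integral_subset_le f_int integrable_continuous_real cont_T) auto
qed

section \<open>Second order equations on the half-line\<close>

lemma at_within_Ici_neq_bot: "0 \<le> t \<Longrightarrow> at t within {0::real..} \<noteq> bot"
  using islimpt_Icc[of 0 "t + 1" t]
  by (simp add: trivial_limit_within flip: at_within_Icc_eq_at_within_Ici[of t "t + 1"])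

lemma hl_deriv_eq:
  "0 \<le> t \<Longrightarrow> (v has_vector_derivative d) (at t within {0..}) \<Longrightarrow> hl_deriv v t = d"
  unfolding hl_deriv_def by (rule vector_derivative_within[OF at_within_Ici_neq_bot])

lemma has_vector_derivative_hl_deriv:
  "v differentiable_on {0..} \<Longrightarrow> 0 \<le> t \<Longrightarrow> (v has_vector_derivative hl_deriv v t) (at t within {0..})"
  unfolding hl_deriv_def differentiable_on_def by (simp add: vector_derivative_works)

text \<open>
  The difference \<open>z\<close> of two solutions has a convex squared norm, because \<open>gradient V\<close> is monotone.
  If \<open>z \<bullet> z'\<close> were ever positive, then the squared norm would grow at least linearly; but finite
  energy makes it grow slower than any linear function. Hence the squared norm remains \<open>0\<close>.
\<close>

lemma strongly_evanescent_unique: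
  fixes V :: "'a::real_inner \<Rightarrow> real"
  assumes V_cont: "continuous_on UNIV V" and V_nonneg: "\<And>x. 0 \<le> V x"
    and mono: "\<And>x y. 0 \<le> (x - y) \<bullet> (gradient V x - gradient V y)"
    and v: "strongly_evanescent V v" and w: "strongly_evanescent V w" and eq: "v 0 = w 0"
    and "0 \<le> t"
  shows "v t = w t"
proof -
  define v' w' where "v' = hl_deriv v" and "w' = hl_deriv w"
  define f where "f r = ((norm (v' r))\<^sup>2 + V (v r)) + ((norm (w' r))\<^sup>2 + V (w r))" for r
  define z z' where "z r = v r - w r" and "z' r = v' r - w' r" for r
  define p where "p r = z r \<bullet> z' r" for r
  have d_v: "(v has_vector_derivative v' r) (at r within {0..})"
      "(v' has_vector_derivative gradient V (v r)) (at r within {0..})"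
    and d_w: "(w has_vector_derivative w' r) (at r within {0..})"
      "(w' has_vector_derivative gradient V (w r)) (at r within {0..})" if "0 \<le> r" for r
    using v w that has_vector_derivative_hl_deriv[of _ r]
    unfolding strongly_evanescent_def global_solution_def C2_halfline_def v'_def w'_def by metis+
  have d_z: "(z has_vector_derivative z' r) (at r)"
    and d_z': "(z' has_vector_derivative gradient V (v r) - gradient V (w r)) (at r)" if "0 < r" for r
    using d_v[of r] d_w[of r] that unfolding z_def z'_def at_within_Ici_interior[OF that]
    by (auto intro!: derivative_intros)
  have cont: "continuous_on {0..} v" "continuous_on {0..} w" "continuous_on {0..} v'" "continuous_on {0..} w'"
    by (rule continuous_on_vector_derivative, rule d_v d_w, simp)+
  have cont_z: "continuous_on {0..} z" "continuous_on {0..} z'" "continuous_on {0..} p"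
    unfolding z_def z'_def p_def by (intro continuous_intros cont)+
  have cont_f: "continuous_on {0..} f"
    unfolding f_def by (intro continuous_intros cont continuous_on_compose2[OF V_cont]) auto
  have f_nonneg: "0 \<le> f r" for r
    unfolding f_def by (intro add_nonneg_nonneg V_nonneg zero_le_power2)
  have "set_integrable lborel {0..} f"
    using v w unfolding strongly_evanescent_def f_def v'_def w'_def by (intro set_integral_add(1)[of lborel "{0..}" "\<lambda>r. (norm (hl_deriv v r))\<^sup>2 + V (v r)"]) simp_all
  then obtain E K where E: "\<And>r. 0 < r \<Longrightarrow> (E has_real_derivative f r) (at r)"
      "continuous_on {0..} E" "\<And>r. 0 \<le> r \<Longrightarrow> E r \<le> K"
    using set_integrable_atLeast_primitive[OF _ cont_f f_nonneg] by blast
  have z'_bound: "(norm (z' r))\<^sup>2 \<le> 2 * f r" for r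
  proof -
    have "(norm (z' r))\<^sup>2 + (norm (v' r + w' r))\<^sup>2 = 2 * (norm (v' r))\<^sup>2 + 2 * (norm (w' r))\<^sup>2"
      by (simp add: z'_def power2_norm_eq_inner inner_add_left inner_add_right inner_diff_left
          inner_diff_right inner_commute)
    then show ?thesis
      using V_nonneg[of "v r"] V_nonneg[of "w r"] zero_le_power2[of "norm (v' r + w' r)"]
      unfolding f_def by (smt (verit))
  qed
  have displacement: "(norm (z t - z s))\<^sup>2 \<le> (t - s) * (2 * E t - 2 * E s)" if "0 \<le> s" "s \<le> t" for s t
  proof (rule energy_displacement_bound[where E = "\<lambda>r. 2 * E r" and e = "\<lambda>r. 2 * f r" and u' = z'])
    show "((\<lambda>r. 2 * E r) has_real_derivative 2 * f r) (at r)" if "s < r" for r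
      using E(1)[of r] that \<open>0 \<le> s\<close> by (auto intro!: derivative_eq_intros)
    show "continuous_on {s..t} z" "continuous_on {s..t} (\<lambda>r. 2 * E r)"
      using that by (auto intro!: continuous_intros continuous_on_subset[OF cont_z(1)] continuous_on_subset[OF E(2)])
  qed (use that d_z z'_bound in auto)
  have p_mono: "p s \<le> p t" if "0 \<le> s" "s \<le> t" for s t
  proof (rule DERIV_nonneg_imp_increasing_open[OF that(2)])
    fix r assume r: "s < r" "r < t"
    have "(p has_real_derivative z r \<bullet> (gradient V (v r) - gradient V (w r)) + z' r \<bullet> z' r) (at r)"
      using d_z[of r] d_z'[of r] r that
      unfolding p_def has_vector_derivative_def has_field_derivative_def
      by (auto intro!: derivative_eq_intros simp: fun_eq_iff algebra_simps)
    moreover have "0 \<le> z r \<bullet> (gradient V (v r) - gradient V (w r))"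
      unfolding z_def by (rule mono)
    ultimately show "\<exists>y. (p has_real_derivative y) (at r) \<and> y \<ge> 0"
      by (meson add_nonneg_nonneg inner_ge_zero)
  qed (use that in \<open>auto intro: continuous_on_subset[OF cont_z(3)]\<close>)
  have d_q: "((\<lambda>r. z r \<bullet> z r) has_real_derivative 2 * p r) (at r)" if "0 < r" for r
    using d_z[OF that] unfolding p_def has_vector_derivative_def has_field_derivative_def
    by (auto intro!: derivative_eq_intros simp: fun_eq_iff algebra_simps inner_commute)
  have p_nonpos: "p t0 \<le> 0" if "0 \<le> t0" for t0
  proof (rule ccontr)
    assume "\<not> p t0 \<le> 0"
    define c where "c = p t0"
    have c: "c > 0" using \<open>\<not> p t0 \<le> 0\<close> by (simp add: c_def)
    have linear: "z s \<bullet> z s + 2 * c * (t - s) \<le> z t \<bullet> z t" if "t0 \<le> s" "s \<le> t" for s t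
    proof -
      have "z s \<bullet> z s - 2 * c * s \<le> z t \<bullet> z t - 2 * c * t"
      proof (rule DERIV_nonneg_imp_increasing_open[OF that(2)])
        fix r assume r: "s < r" "r < t"
        have "((\<lambda>r. z r \<bullet> z r - 2 * c * r) has_real_derivative 2 * p r - 2 * c) (at r)"
          using d_q[of r] r that \<open>0 \<le> t0\<close> by (auto intro!: derivative_eq_intros)
        moreover have "c \<le> p r"
          unfolding c_def using r that \<open>0 \<le> t0\<close> by (intro p_mono) auto
        ultimately show "\<exists>y. ((\<lambda>r. z r \<bullet> z r - 2 * c * r) has_real_derivative y) (at r) \<and> y \<ge> 0"
          by force
        next
        show "continuous_on {s..t} (\<lambda>r. z r \<bullet> z r - 2 * c * r)"
          using that \<open>0 \<le> t0\<close> by (intro continuous_intros continuous_on_subset[OF cont_z(1)]) auto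
      qed
      then show ?thesis by (simp add: algebra_simps)
    qed
    have bdd: "bdd_above (E ` {t0..})" by (rule bdd_aboveI2[of _ _ K]) (use E(3) \<open>0 \<le> t0\<close> in auto)
    \<comment> \<open>After time \<open>s\<close> the remaining energy is too small for growth at rate \<open>c\<close>.\<close>
    have "(SUP r\<in>{t0..}. E r) - c / 4 < (SUP r\<in>{t0..}. E r)" using c by simp
    then obtain s where s: "t0 \<le> s" "(SUP r\<in>{t0..}. E r) - c / 4 < E s"
      using less_cSUP_iff[OF _ bdd] by auto
    have tail: "E r - E s \<le> c / 4" if "s \<le> r" for r
      using cSUP_upper[OF _ bdd, of r] s that by auto
    \<comment> \<open>At this time \<open>c * (t - s)\<close> has overtaken \<open>z s \<bullet> z s\<close>, so the linear lower bound exceeds the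
      upper bound from the displacement.\<close>
    define t where "t = s + (z s \<bullet> z s) / c + 1"
    have t: "s < t" "c * (t - s) = z s \<bullet> z s + c"
      using c by (auto simp: t_def field_simps add_pos_nonneg)
    have "(norm (z t - z s))\<^sup>2 \<le> (t - s) * (2 * E t - 2 * E s)"
      using s t \<open>0 \<le> t0\<close> by (intro displacement) auto
    also have "\<dots> \<le> (t - s) * (c / 2)"
      using tail[of t] t by (intro mult_left_mono) auto
    finally have small: "2 * (norm (z t - z s))\<^sup>2 \<le> c * (t - s)" by (simp add: mult.commute)
    have "(norm (z t - 2 *\<^sub>R z s))\<^sup>2 + z t \<bullet> z t = 2 * (z s \<bullet> z s) + 2 * (norm (z t - z s))\<^sup>2"
      by (simp add: power2_norm_eq_inner inner_diff_left inner_diff_right inner_commute)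
    then have "z t \<bullet> z t \<le> 2 * (z s \<bullet> z s) + 2 * (norm (z t - z s))\<^sup>2"
      using zero_le_power2[of "norm (z t - 2 *\<^sub>R z s)"] by linarith
    with small linear[of s t] s t c show False by (simp add: mult.assoc)
  qed
  have "z t \<bullet> z t \<le> z 0 \<bullet> z 0"
  proof (rule DERIV_nonpos_imp_decreasing_open[OF \<open>0 \<le> t\<close>])
    show "\<exists>y. ((\<lambda>r. z r \<bullet> z r) has_real_derivative y) (at r) \<and> y \<le> 0" if "0 < r" for r
      using d_q[OF that] p_nonpos[of r] that by force
    show "continuous_on {0..t} (\<lambda>r. z r \<bullet> z r)"
      by (intro continuous_intros continuous_on_subset[OF cont_z(1)]) auto
  qed
  then show ?thesis by (simp add: z_def eq dot_square_norm)
qed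

section \<open>The gradient flow\<close>

locale C2_potential =
  fixes \<psi> :: "'a::{real_inner, banach} \<Rightarrow> real" and F :: "'a \<Rightarrow> 'a" and A :: "'a \<Rightarrow> 'a \<Rightarrow>\<^sub>L 'a"
  assumes \<psi>_deriv: "\<And>x. (\<psi> has_derivative (\<lambda>h. F x \<bullet> h)) (at x)"
    and F_deriv: "\<And>x. (F has_derivative blinfun_apply (A x)) (at x)"
    and A_cont: "continuous_on UNIV A"
begin

sublocale C1_vector_field "\<lambda>x. - F x" "\<lambda>x. - A x"
proof
  show "((\<lambda>x. - F x) has_derivative blinfun_apply (- A x)) (at x)" for x
    using has_derivative_minus[OF F_deriv[of x]] by (simp add: blinfun.minus_left[abs_def])
  show "continuous_on UNIV (\<lambda>x. - A x)"
    by (intro continuous_intros A_cont)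
qed

lemma gradient_\<psi>: "gradient \<psi> x = F x"
  by (rule gradient_eq[OF \<psi>_deriv])

lemma \<psi>_along_curve:
  assumes "(u has_vector_derivative - F (u t)) (at t within S)"
  shows "((\<lambda>t. \<psi> (u t)) has_real_derivative - (norm (F (u t)))\<^sup>2) (at t within S)"
proof -
  have "((\<lambda>t. \<psi> (u t)) has_derivative (\<lambda>h. F (u t) \<bullet> (h *\<^sub>R (- F (u t))))) (at t within S)"
    using has_derivative_compose[OF assms[unfolded has_vector_derivative_def] \<psi>_deriv] .
  moreover have "(\<lambda>h. F (u t) \<bullet> (h *\<^sub>R (- F (u t)))) = (*) (- (norm (F (u t)))\<^sup>2)"
    by (simp add: fun_eq_iff power2_norm_eq_inner)
  ultimately show ?thesis by (simp add: has_field_derivative_def)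
qed

text \<open>
  Along the flow \<open>\<psi>\<close> decreases at the rate \<open>(norm u')\<^sup>2\<close>, so a lower bound of \<open>\<psi>\<close> bounds the
  energy and makes all curves with the same starting point uniformly Hoelder continuous.
\<close>

lemma gradient_flow_exists:
  assumes bdd: "bdd_below (range \<psi>)"
  shows "\<exists>u. gradient_flow \<psi> u \<and> u 0 = x0"
proof -
  obtain m where m: "\<And>x. m \<le> \<psi> x" using bdd unfolding bdd_below_def by auto
  have "\<exists>u. u 0 = x0 \<and> (\<forall>T. integral_curve (\<lambda>x. - F x) T u)"
  proof (rule global_integral_curve)
    fix T u and s t :: real
    assume u: "integral_curve (\<lambda>x. - F x) T u" "u 0 = x0" and st: "0 \<le> s" "s \<le> t" "t \<le> T"
    have bound: "(norm (u b - u a))\<^sup>2 \<le> (b - a) * (- \<psi> (u b) - - \<psi> (u a))" if "0 \<le> a" "a \<le> b" "b \<le> T" for a b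
    proof (rule energy_displacement_bound[where e = "\<lambda>r. (norm (F (u r)))\<^sup>2" and u' = "\<lambda>r. - F (u r)"])
      show u_cont: "continuous_on {a..b} u"
        using that by (intro continuous_on_subset[OF integral_curve_continuous_on[OF u(1)]]) auto
      have "continuous_on UNIV \<psi>"
        using \<psi>_deriv by (meson continuous_at_imp_continuous_on has_derivative_continuous)
      then show "continuous_on {a..b} (\<lambda>r. - \<psi> (u r))"
        by (intro continuous_intros continuous_on_compose2[OF _ u_cont, of UNIV \<psi>]) auto
      fix r assume r: "a < r" "r < b"
      show "(u has_vector_derivative - F (u r)) (at r)"
        using integral_curve_interior[OF u(1), of r] r that by simp
      from DERIV_minus[OF \<psi>_along_curve[OF this]]
      show "((\<lambda>r. - \<psi> (u r)) has_real_derivative (norm (F (u r)))\<^sup>2) (at r)" by simp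
    qed (use that in auto)
    have "\<psi> (u s) \<le> \<psi> x0"
    proof (cases "s = 0")
      case False
      then have "s > 0" using st by simp
      have "0 \<le> s * (\<psi> x0 - \<psi> (u s))"
        using order_trans[OF zero_le_power2 bound[of 0 s]] st u by simp
      then show ?thesis using \<open>s > 0\<close> by (simp add: zero_le_mult_iff)
    qed (simp add: u)
    then have "(t - s) * (- \<psi> (u t) - - \<psi> (u s)) \<le> (t - s) * (\<psi> x0 - m)"
      using m[of "u t"] st by (intro mult_left_mono) auto
    with bound[OF st] show "(norm (u t - u s))\<^sup>2 \<le> (\<psi> x0 - m) * (t - s)"
      by (simp add: mult.commute)
  qed
  then obtain u where u: "u 0 = x0" "\<And>T. integral_curve (\<lambda>x. - F x) T u" by blast
  have "(u has_vector_derivative - F (u t)) (at t within {0..})" if "0 \<le> t" for t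
  proof -
    have "(u has_vector_derivative - F (u t)) (at t within {0..t + 1})"
      using u(2)[of "t + 1"] that unfolding integral_curve_def by simp
    then show ?thesis by (simp add: at_within_Icc_eq_at_within_Ici)
  qed
  then show ?thesis using u(1) unfolding gradient_flow_def gradient_\<psi> by blast
qed

text \<open>
  The chain rule gives the adjoint of \<open>A x\<close> applied to \<open>F x\<close>, which the symmetry of the Hessian
  turns into \<open>A x (F x)\<close>.
\<close>

lemma half_norm_square_deriv:
  assumes "\<And>x. V x = 1 / 2 * (norm (F x))\<^sup>2"
  shows "(V has_derivative (\<lambda>h. A x (F x) \<bullet> h)) (at x)"
proof -
  have "((\<lambda>x. 1 / 2 * (F x \<bullet> F x)) has_derivative (\<lambda>h. 1 / 2 * (F x \<bullet> A x h + A x h \<bullet> F x))) (at x)"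
    by (intro derivative_intros F_deriv)
  moreover have "V = (\<lambda>x. 1 / 2 * (F x \<bullet> F x))"
    using assms by (simp add: fun_eq_iff power2_norm_eq_inner)
  moreover have "1 / 2 * (F x \<bullet> A x h + A x h \<bullet> F x) = A x (F x) \<bullet> h" for h
    using hessian_symmetric[OF \<psi>_deriv F_deriv A_cont, of x "F x" h] by (simp add: inner_commute)
  ultimately show ?thesis by simp
qed

text \<open>
  With \<open>u' = - F (u)\<close> the chain rule gives \<open>u'' = A (u) (F (u))\<close>, which is \<open>gradient V (u)\<close> by
  the symmetry of the Hessian, and the integrand is \<open>- 3 / 2\<close> times the derivative of \<open>\<psi> (u)\<close>.
\<close>

lemma gradient_flow_strongly_evanescent:
  assumes V: "\<And>x. V x = 1 / 2 * (norm (F x))\<^sup>2" and bdd: "bdd_below (range \<psi>)"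
    and "gradient_flow \<psi> u"
  shows "strongly_evanescent V u"
proof -
  have d1: "(u has_vector_derivative - F (u t)) (at t within {0..})" if "0 \<le> t" for t
    using assms that by (simp add: gradient_flow_def gradient_\<psi>)
  have hl1: "hl_deriv u t = - F (u t)" if "0 \<le> t" for t
    by (rule hl_deriv_eq[OF that d1[OF that]])
  have d2: "(hl_deriv u has_vector_derivative A (u t) (F (u t))) (at t within {0..})" if "0 \<le> t" for t
  proof -
    have "((\<lambda>t. - F (u t)) has_vector_derivative A (u t) (F (u t))) (at t within {0..})"
      using has_derivative_minus[OF has_derivative_compose[OF d1[OF that, unfolded has_vector_derivative_def] F_deriv]]
      by (simp add: has_vector_derivative_def blinfun.minus_right blinfun.scaleR_right)
    then show ?thesis
      by (rule has_vector_derivative_transform[rotated 2]) (use that hl1 in auto)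
  qed
  have hl2: "hl_deriv (hl_deriv u) t = A (u t) (F (u t))" if "0 \<le> t" for t
    by (rule hl_deriv_eq[OF that d2[OF that]])
  have u_cont: "continuous_on {0..} u"
    using d1 unfolding continuous_on_eq_continuous_within by (auto intro: has_vector_derivative_continuous)
  have F_cont: "continuous_on UNIV F"
    using F_deriv by (meson continuous_at_imp_continuous_on has_derivative_continuous)
  have Fu_cont: "continuous_on {0..} (\<lambda>t. F (u t))" and Au_cont: "continuous_on {0..} (\<lambda>t. A (u t))"
    by (rule continuous_on_compose2[OF F_cont u_cont] continuous_on_compose2[OF A_cont u_cont]; simp)+
  have "C2_halfline u"
    unfolding C2_halfline_def
  proof (intro conjI)
    show "u differentiable_on {0..}" "hl_deriv u differentiable_on {0..}"
      using d1 d2 unfolding differentiable_on_def by (auto intro: differentiableI_vector)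
    have "continuous_on {0..} (\<lambda>t. A (u t) (F (u t)))"
      by (intro continuous_intros Fu_cont Au_cont)
    then show "continuous_on {0..} (hl_deriv (hl_deriv u))"
      by (rule continuous_on_eq) (simp add: hl2)
  qed
  moreover have "gradient V x = A x (F x)" for x
    by (rule gradient_eq[OF half_norm_square_deriv[OF V]])
  ultimately have "global_solution V u"
    unfolding global_solution_def by (simp add: hl2)
  moreover have "set_integrable lborel {0..} (\<lambda>t. (norm (hl_deriv u t))\<^sup>2 + V (u t))"
  proof -
    obtain m where m: "\<And>x. m \<le> \<psi> x" using bdd unfolding bdd_below_def by auto
    have "set_integrable lborel {0..} (\<lambda>t. 3 / 2 * (norm (F (u t)))\<^sup>2)"
    proof (rule set_integrable_atLeast_bounded_primitive)
      show "((\<lambda>t. - (3 / 2) * \<psi> (u t)) has_real_derivative 3 / 2 * (norm (F (u t)))\<^sup>2) (at t within {0..})"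
        if "0 \<le> t" for t
        using DERIV_cmult[OF \<psi>_along_curve[OF d1[OF that]], of "- (3 / 2)"] by simp
      show "continuous_on {0..} (\<lambda>t. 3 / 2 * (norm (F (u t)))\<^sup>2)"
        by (intro continuous_intros Fu_cont)
      show "- (3 / 2) * \<psi> (u t) \<le> - (3 / 2) * m" for t using m[of "u t"] by simp
    qed simp
    then show ?thesis
      by (rule set_integrable_cong[THEN iffD1, rotated -1]) (auto simp: hl1 V)
  qed
  ultimately show ?thesis unfolding strongly_evanescent_def by blast
qed

end

theorem proposition3p16:
  fixes \<psi> V :: "'a::{real_inner, banach} \<Rightarrow> real" and u0 :: 'a
  assumes "C2_on_space \<psi>"
    and "bdd_below (range \<psi>)"
    and "\<And>x. V x = 1 / 2 * (norm (gradient \<psi> x))\<^sup>2"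
    and "convex_on UNIV V"
  shows "\<exists>v. strongly_evanescent V v \<and> v 0 = u0 \<and>
             (\<forall>w. strongly_evanescent V w \<and> w 0 = u0 \<longrightarrow> (\<forall>t\<ge>0. w t = v t)) \<and>
             gradient_flow \<psi> v \<and>
             (\<forall>u. gradient_flow \<psi> u \<and> u 0 = u0 \<longrightarrow> (\<forall>t\<ge>0. u t = v t))"
proof -
  obtain F A where FA: "\<And>x. (\<psi> has_derivative (\<lambda>h. F x \<bullet> h)) (at x)"
      "\<And>x. (F has_derivative blinfun_apply (A x)) (at x)" "continuous_on UNIV A"
    using C2_on_space_imp_gradient_derivative[OF assms(1)] by blast
  interpret C2_potential \<psi> F A by unfold_locales (fact FA)+
  have V: "V x = 1 / 2 * (norm (F x))\<^sup>2" for x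
    using assms(3) by (simp add: gradient_\<psi>)
  note V_deriv = half_norm_square_deriv[OF V]
  have "continuous_on UNIV V"
    using V_deriv by (meson continuous_at_imp_continuous_on has_derivative_continuous)
  moreover have "0 \<le> V x" for x by (simp add: V)
  moreover have "0 \<le> (x - y) \<bullet> (gradient V x - gradient V y)" for x y
    using convex_gradient_monotone[OF assms(4) V_deriv] by (simp add: gradient_eq[OF V_deriv])
  ultimately have unique: "w t = v t"
    if "strongly_evanescent V v" "strongly_evanescent V w" "w 0 = v 0" "0 \<le> t" for v w t
    using strongly_evanescent_unique that by blast
  note evanescent = gradient_flow_strongly_evanescent[OF V assms(2)]
  obtain v where v: "gradient_flow \<psi> v" "v 0 = u0"
    using gradient_flow_exists[OF assms(2)] by blast
  show ?thesis
    using v evanescent unique[OF evanescent[OF v(1)]] by (intro exI[of _ v]) auto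
qed

end
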